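(* Let $G$ be a graph. If $v\in V(G)$ then $M_A(G)-v = M_A(G^{v})-v$.
   Context: Graphs are finite and may have loops and parallel edges. $\mathcal{A}(G)$ is the symmetric $V(G)\times V(G)$ matrix over $GF(2)$ with $a_{vv}=1$ iff $v$ is looped and, for $v\ne w$, $a_{vw}=1$ iff $v,w$ are adjacent. The adjacency matroid $M_A(G)$ is the binary matroid on $V(G)$ whose circuits are the minimal nonempty $S\subseteq V(G)$ such that the columns of $\mathcal{A}(G)$ indexed by $S$ are linearly dependent over $GF(2)$. The local complement $G^{v}$ is the looped simple graph (no parallel edges, at most one loop per vertex) obtained from $G$ by toggling the loop status of every neighbor $w\neq v$ of $v$ and toggling the adjacency status of every pair of distinct neighbors of $v$ (both different from $v$); all other adjacencies and loop statuses, including the loop status of $v$, are unchanged, and parallel edges are replaced by single edges. For a matroid $M$ on $V$ and $v\in V$, the deletion $M-v$ is the matroid on $V\setminus\{v\}$ whose circuits are the circuits of $M$ not containing $v$. *)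

theory Defs
  imports Main "HOL-Library.Z2"
begin

section \<open>Finite graphs with loops and parallel edges\<close>

record ('v, 'e) multigraph =
  verts :: "'v set"
  edges :: "'e set"
  ends :: "'e \<Rightarrow> 'v set"

text \<open>An edge with a single end is a loop. Distinct edges may have the same ends.\<close>

definition finite_multigraph :: "('v, 'e) multigraph \<Rightarrow> bool" where
  "finite_multigraph G \<longleftrightarrow> finite (verts G) \<and> finite (edges G) \<and>
     (\<forall>e\<in>edges G. ends G e \<subseteq> verts G \<and> card (ends G e) \<in> {1, 2})"

definition looped :: "('v, 'e) multigraph \<Rightarrow> 'v \<Rightarrow> bool" where
  "looped G u \<longleftrightarrow> (\<exists>e\<in>edges G. ends G e = {u})"

definition adjacent :: "('v, 'e) multigraph \<Rightarrow> 'v \<Rightarrow> 'v \<Rightarrow> bool" where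
  "adjacent G u w \<longleftrightarrow> u \<noteq> w \<and> (\<exists>e\<in>edges G. ends G e = {u, w})"

definition adjacency_matrix :: "('v, 'e) multigraph \<Rightarrow> 'v \<Rightarrow> 'v \<Rightarrow> bit" where
  "adjacency_matrix G u w = (if u = w then of_bool (looped G u) else of_bool (adjacent G u w))"

section \<open>Local complementation\<close>

text \<open>In the result an edge is identified with its set of ends, so there are no parallel edges.\<close>

definition local_complement :: "('v, 'e) multigraph \<Rightarrow> 'v \<Rightarrow> ('v, 'v set) multigraph" where
  "local_complement G v =
     \<lparr> verts = verts G,
       edges =
         {{u} | u. u \<in> verts G \<and> (if adjacent G v u then \<not> looped G u else looped G u)} \<union>
         {{u, w} | u w. u \<in> verts G \<and> w \<in> verts G \<and> u \<noteq> w \<and>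
            (if adjacent G v u \<and> adjacent G v w then \<not> adjacent G u w else adjacent G u w)},
       ends = (\<lambda>e. e) \<rparr>"

section \<open>Matroids given by their circuits\<close>

record 'v matroid =
  ground :: "'v set"
  circuits :: "'v set set"

definition is_matroid :: "'v matroid \<Rightarrow> bool" where
  "is_matroid M \<longleftrightarrow> finite (ground M) \<and> (\<forall>C\<in>circuits M. C \<subseteq> ground M) \<and>
     {} \<notin> circuits M \<and>
     (\<forall>C\<in>circuits M. \<forall>D\<in>circuits M. C \<subseteq> D \<longrightarrow> C = D) \<and>
     (\<forall>C\<in>circuits M. \<forall>D\<in>circuits M. \<forall>x\<in>C \<inter> D. C \<noteq> D \<longrightarrow>
        (\<exists>B\<in>circuits M. B \<subseteq> (C \<union> D) - {x}))"

definition matroid_delete :: "'v matroid \<Rightarrow> 'v \<Rightarrow> 'v matroid" where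
  "matroid_delete M v =
     \<lparr> ground = ground M - {v}, circuits = {C \<in> circuits M. v \<notin> C} \<rparr>"

text \<open>Dependence of the columns indexed by \<open>S\<close> as a family: two equal columns with distinct
  indices are dependent. The set \<open>R\<close> indexes the rows.\<close>

definition columns_dependent :: "('r \<Rightarrow> 'c \<Rightarrow> 'k::field) \<Rightarrow> 'r set \<Rightarrow> 'c set \<Rightarrow> bool" where
  "columns_dependent A R S \<longleftrightarrow>
     (\<exists>c. (\<exists>w\<in>S. c w \<noteq> 0) \<and> (\<forall>u\<in>R. (\<Sum>w\<in>S. c w * A u w) = 0))"

definition adjacency_matroid :: "('v, 'e) multigraph \<Rightarrow> 'v matroid" where
  "adjacency_matroid G =
     \<lparr> ground = verts G,
       circuits = {S. S \<subseteq> verts G \<and> S \<noteq> {} \<and>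
         columns_dependent (adjacency_matrix G) (verts G) S \<and>
         (\<forall>T. T \<noteq> {} \<and> T \<subset> S \<longrightarrow>
            \<not> columns_dependent (adjacency_matrix G) (verts G) T)} \<rparr>"

section \<open>Basic properties of the definitions\<close>

lemma finite_multigraph_local_complement:
  assumes "finite_multigraph G"
  shows "finite_multigraph (local_complement G v)"
proof -
  have "edges (local_complement G v) \<subseteq> Pow (verts G)"
    by (auto simp: local_complement_def)
  moreover have "finite (verts G)"
    using assms by (simp add: finite_multigraph_def)
  ultimately have "finite (edges (local_complement G v))"
    by (meson finite_Pow_iff finite_subset)
  with \<open>finite (verts G)\<close> show ?thesis
    by (auto simp: finite_multigraph_def local_complement_def)
qed

lemma looped_local_complement:
  assumes "u \<in> verts G"
  shows "looped (local_complement G v) u \<longleftrightarrow> (looped G u \<noteq> adjacent G v u)"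
proof -
  have loop: "{u} \<in> {{x} | x. P x} \<longleftrightarrow> P u" for P
    by auto
  have edge: "{u} \<notin> {{x, y} | x y. x \<in> V \<and> y \<in> V \<and> x \<noteq> y \<and> R x y}" for V R
    by blast
  have "looped (local_complement G v) u \<longleftrightarrow> {u} \<in> edges (local_complement G v)"
    unfolding looped_def by (simp add: local_complement_def)
  also have "\<dots> \<longleftrightarrow> (if adjacent G v u then \<not> looped G u else looped G u)"
    using assms by (simp only: local_complement_def multigraph.simps Un_iff loop edge simp_thms)
  finally show ?thesis by simp
qed

lemma adjacent_commute: "adjacent G u w \<longleftrightarrow> adjacent G w u"
  by (auto simp: adjacent_def insert_commute)

lemma adjacent_local_complement:
  assumes "u \<in> verts G" "w \<in> verts G" "u \<noteq> w"
  shows "adjacent (local_complement G v) u w \<longleftrightarrow>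
    (adjacent G u w \<noteq> (adjacent G v u \<and> adjacent G v w))"
proof -
  let ?R = "\<lambda>x y. if adjacent G v x \<and> adjacent G v y then \<not> adjacent G x y else adjacent G x y"
  have loop: "{u, w} \<notin> {{x} | x. P x}" for P
    using assms(3) by blast
  have edge: "{u, w} \<in> {{x, y} | x y. x \<in> verts G \<and> y \<in> verts G \<and> x \<noteq> y \<and> R x y} \<longleftrightarrow>
      R u w \<or> R w u" for R
    using assms by (auto simp: doubleton_eq_iff)
  have "adjacent (local_complement G v) u w \<longleftrightarrow> {u, w} \<in> edges (local_complement G v)"
    using assms(3) unfolding adjacent_def by (simp add: local_complement_def)
  also have "\<dots> \<longleftrightarrow> ?R u w \<or> ?R w u"
    by (simp only: local_complement_def multigraph.simps Un_iff loop edge simp_thms)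
  finally show ?thesis
    using adjacent_commute [of G u w] by (cases "adjacent G u w") auto
qed

lemma columns_dependent_mono:
  assumes "columns_dependent A R S" "S \<subseteq> T" "finite T"
  shows "columns_dependent A R T"
proof -
  obtain c where c: "\<exists>w\<in>S. c w \<noteq> 0" "\<forall>u\<in>R. (\<Sum>w\<in>S. c w * A u w) = 0"
    using assms(1) by (auto simp: columns_dependent_def)
  define d where "d w = (if w \<in> S then c w else 0)" for w
  have "(\<Sum>w\<in>T. d w * A u w) = (\<Sum>w\<in>S. c w * A u w)" for u
    using assms(2,3) by (intro sum.mono_neutral_cong_right) (auto simp: d_def)
  then have "\<forall>u\<in>R. (\<Sum>w\<in>T. d w * A u w) = 0"
    using c by simp
  moreover have "\<exists>w\<in>T. d w \<noteq> 0"
    using c(1) assms(2) by (auto simp: d_def)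
  ultimately show ?thesis
    by (auto simp: columns_dependent_def)
qed

lemma columns_dependent_nonempty: "columns_dependent A R S \<Longrightarrow> S \<noteq> {}"
  by (auto simp: columns_dependent_def)

lemma dependent_contains_circuit:
  assumes "finite (verts G)" "S \<subseteq> verts G"
    and "columns_dependent (adjacency_matrix G) (verts G) S"
  shows "\<exists>C\<in>circuits (adjacency_matroid G). C \<subseteq> S"
proof -
  let ?D = "columns_dependent (adjacency_matrix G) (verts G)"
  have "finite S"
    using assms(1,2) finite_subset by blast
  then show ?thesis
    using assms(2,3)
  proof (induction S rule: finite_psubset_induct)
    case (psubset S)
    show ?case
    proof (cases "\<exists>T. T \<subset> S \<and> ?D T")
      case True
      then obtain T where T: "T \<subset> S" "?D T" by blast
      moreover have "T \<subseteq> verts G" using T(1) psubset.prems(1) by blast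
      ultimately obtain C where "C \<in> circuits (adjacency_matroid G)" "C \<subseteq> T"
        using psubset.IH by blast
      then show ?thesis using T(1) by blast
    next
      case False
      moreover have "S \<noteq> {}" by (rule columns_dependent_nonempty [OF psubset.prems(2)])
      ultimately have "S \<in> circuits (adjacency_matroid G)"
        unfolding adjacency_matroid_def using psubset.prems by simp
      then show ?thesis by blast
    qed
  qed
qed

lemma circuit_sum:
  assumes "finite (verts G)" "C \<in> circuits (adjacency_matroid G)" "u \<in> verts G"
  shows "(\<Sum>w\<in>C. adjacency_matrix G u w) = 0"
proof -
  let ?A = "adjacency_matrix G"
  have C: "C \<subseteq> verts G" "columns_dependent ?A (verts G) C"
    "\<And>T. T \<noteq> {} \<Longrightarrow> T \<subset> C \<Longrightarrow> \<not> columns_dependent ?A (verts G) T"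
    using assms(2) by (simp_all add: adjacency_matroid_def)
  have fin: "finite C" using C(1) assms(1) finite_subset by blast
  obtain c where c: "\<exists>w\<in>C. c w \<noteq> 0" "\<And>u. u \<in> verts G \<Longrightarrow> (\<Sum>w\<in>C. c w * ?A u w) = 0"
    using C(2) unfolding columns_dependent_def by blast
  define T where "T = {w\<in>C. c w \<noteq> 0}"
  have ne: "T \<noteq> {}" and sub: "T \<subseteq> C" using c(1) by (auto simp: T_def)
  have "(\<Sum>w\<in>T. c w * ?A x w) = (\<Sum>w\<in>C. c w * ?A x w)" for x
    using fin by (intro sum.mono_neutral_left) (auto simp: T_def)
  then have "\<forall>x\<in>verts G. (\<Sum>w\<in>T. c w * ?A x w) = 0"
    using c(2) by simp
  moreover have "\<exists>w\<in>T. c w \<noteq> 0" using ne by (auto simp: T_def)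
  ultimately have "columns_dependent ?A (verts G) T"
    unfolding columns_dependent_def by blast
  then have "T = C" using C(3) ne sub by blast
  then have "c w = 1" if "w \<in> C" for w
    using that bit_not_zero_iff [of "c w"] unfolding T_def by blast
  then have "(\<Sum>w\<in>C. c w * ?A u w) = (\<Sum>w\<in>C. ?A u w)"
    by (intro sum.cong) simp_all
  with c(2) [OF assms(3)] show ?thesis by simp
qed

lemma is_matroid_adjacency_matroid:
  assumes "finite_multigraph G"
  shows "is_matroid (adjacency_matroid G)"
proof -
  let ?A = "adjacency_matrix G" and ?M = "adjacency_matroid G"
  have fin: "finite (verts G)" using assms by (simp add: finite_multigraph_def)
  have antichain: "C = D" if "C \<in> circuits ?M" "D \<in> circuits ?M" "C \<subseteq> D" for C D
  proof (rule ccontr)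
    assume "C \<noteq> D"
    with that(3) have "C \<subset> D" by blast
    with that(1,2) show False by (simp add: adjacency_matroid_def) blast
  qed
  have elim: "\<exists>B\<in>circuits ?M. B \<subseteq> (C \<union> D) - {x}"
    if CD: "C \<in> circuits ?M" "D \<in> circuits ?M" and x: "x \<in> C" "x \<in> D" and ne: "C \<noteq> D" for C D x
  proof -
    have sub: "C \<subseteq> verts G" "D \<subseteq> verts G" using CD by (auto simp: adjacency_matroid_def)
    then have finCD: "finite C" "finite D" using fin finite_subset by blast+
    define S where "S = (C - D) \<union> (D - C)"
    have "(\<Sum>w\<in>S. ?A u w) = 0" if "u \<in> verts G" for u
    proof -
      let ?s = "\<lambda>X. \<Sum>w\<in>X. ?A u w"
      have cancel: "q + r = 0" if "p + q = 0" "p + r = 0" for p q r :: bit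
        using that by (cases p; cases q; cases r) simp_all
      have split: "?s S = ?s (C - D) + ?s (D - C)"
        unfolding S_def using finCD by (intro sum.union_disjoint) auto
      have "?s (C \<inter> D) + ?s (C - D) = 0"
        unfolding sum.Int_Diff [OF finCD(1), of _ D, symmetric] by (rule circuit_sum [OF fin CD(1) that])
      moreover have "?s (C \<inter> D) + ?s (D - C) = 0"
        unfolding Int_commute [of C] sum.Int_Diff [OF finCD(2), of _ C, symmetric]
        by (rule circuit_sum [OF fin CD(2) that])
      ultimately show ?thesis
        unfolding split by (rule cancel)
    qed
    then have "\<forall>u\<in>verts G. (\<Sum>w\<in>S. 1 * ?A u w) = 0"
      by (intro ballI) (simp only: mult_1_left)
    moreover have "\<exists>w\<in>S. (1::bit) \<noteq> 0" using ne by (auto simp: S_def)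
    ultimately have "columns_dependent ?A (verts G) S"
      unfolding columns_dependent_def by (intro exI [of _ "\<lambda>_. 1"] conjI)
    moreover have "S \<subseteq> verts G" using sub by (auto simp: S_def)
    ultimately obtain B where "B \<in> circuits ?M" "B \<subseteq> S"
      using dependent_contains_circuit [OF fin] by blast
    moreover have "S \<subseteq> (C \<union> D) - {x}" using x by (auto simp: S_def)
    ultimately show ?thesis by blast
  qed
  show ?thesis
    unfolding is_matroid_def
  proof (intro conjI ballI impI)
    fix C D x
    assume "C \<in> circuits ?M" "D \<in> circuits ?M" "x \<in> C \<inter> D" "C \<noteq> D"
    then show "\<exists>B\<in>circuits ?M. B \<subseteq> (C \<union> D) - {x}"
      by (intro elim) simp_all
  next
    fix C D
    assume "C \<in> circuits ?M" "D \<in> circuits ?M" "C \<subseteq> D"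
    then show "C = D" by (rule antichain)
  qed (use fin in \<open>simp_all add: adjacency_matroid_def\<close>)
qed

lemma is_matroid_matroid_delete:
  assumes "is_matroid M"
  shows "is_matroid (matroid_delete M v)"
proof -
  note M = assms [unfolded is_matroid_def]
  note fin = M [THEN conjunct1]
    and sub = M [THEN conjunct2, THEN conjunct1]
    and nonempty = M [THEN conjunct2, THEN conjunct2, THEN conjunct1]
    and antichain = M [THEN conjunct2, THEN conjunct2, THEN conjunct2, THEN conjunct1]
    and elim = M [THEN conjunct2, THEN conjunct2, THEN conjunct2, THEN conjunct2]
  show ?thesis
    unfolding is_matroid_def
  proof (intro conjI ballI impI)
    fix C D x
    assume "C \<in> circuits (matroid_delete M v)" "D \<in> circuits (matroid_delete M v)"
      "x \<in> C \<inter> D" "C \<noteq> D"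
    then have CD: "C \<in> circuits M" "D \<in> circuits M" "x \<in> C \<inter> D" "C \<noteq> D" "v \<notin> C" "v \<notin> D"
      by (simp_all add: matroid_delete_def)
    from elim [rule_format, OF CD(1-4)] obtain B
      where "B \<in> circuits M" "B \<subseteq> (C \<union> D) - {x}" ..
    with CD(5,6) show "\<exists>B\<in>circuits (matroid_delete M v). B \<subseteq> (C \<union> D) - {x}"
      by (auto simp: matroid_delete_def)
  next
    fix C D
    assume "C \<in> circuits (matroid_delete M v)" "D \<in> circuits (matroid_delete M v)" "C \<subseteq> D"
    then have "C \<in> circuits M" "D \<in> circuits M" "C \<subseteq> D"
      by (simp_all add: matroid_delete_def)
    then show "C = D"
      using antichain by blast
  next
    fix C
    assume "C \<in> circuits (matroid_delete M v)"
    then have "C \<in> circuits M" "v \<notin> C"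
      by (simp_all add: matroid_delete_def)
    then have "C \<subseteq> ground M - {v}"
      using sub by blast
    then show "C \<subseteq> ground (matroid_delete M v)"
      by (simp add: matroid_delete_def)
  qed (use fin nonempty in \<open>simp_all add: matroid_delete_def\<close>)
qed

end

theory Submission imports Defs begin

text \<open>
  Away from the column of \<open>v\<close>, local complementation at \<open>v\<close> is a row operation: over \<open>GF(2)\<close>,
  toggling all loops and adjacencies among the neighbors of \<open>v\<close> adds row \<open>v\<close> of the adjacency
  matrix to every row indexed by a neighbor of \<open>v\<close>
  (lemma \<open>adjacency_matrix_local_complement\<close>). Row \<open>v\<close> itself does not change, so the operation
  is invertible and keeps the linear relations among the columns
  (lemma \<open>columns_dependent_row_operation\<close>). A set that avoids \<open>v\<close>, and then each of its subsets,
  is therefore dependent for \<open>G\<close> iff it is for the local complement; so the two matroids have the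
  same circuits avoiding \<open>v\<close>, which are the circuits left by the deletion of \<open>v\<close>.
\<close>

text \<open>
  The hypothesis \<open>n p = 0\<close> makes the operation invertible: row \<open>p\<close>, the one that is added to the
  others, is the same in both matrices. Hence a combination of columns that vanishes in row \<open>p\<close> of
  one matrix vanishes in row \<open>p\<close> of the other, and then the other rows agree on it.
\<close>

lemma columns_dependent_row_operation:
  assumes "p \<in> R" "n p = 0"
    and B: "\<And>u w. u \<in> R \<Longrightarrow> w \<in> S \<Longrightarrow> B u w = A u w + n u * A p w"
  shows "columns_dependent B R S \<longleftrightarrow> columns_dependent A R S"
proof -
  have combination:
    "(\<Sum>w\<in>S. c w * B u w) = (\<Sum>w\<in>S. c w * A u w) + n u * (\<Sum>w\<in>S. c w * A p w)"
    if "u \<in> R" for c u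
    using that
    by (simp add: B sum.distrib sum_distrib_left algebra_simps cong: sum.cong)
  then have row_p: "(\<Sum>w\<in>S. c w * B p w) = (\<Sum>w\<in>S. c w * A p w)" for c
    using assms(1,2) by simp
  have "(\<forall>u\<in>R. (\<Sum>w\<in>S. c w * B u w) = 0) \<longleftrightarrow> (\<forall>u\<in>R. (\<Sum>w\<in>S. c w * A u w) = 0)" for c
  proof (cases "(\<Sum>w\<in>S. c w * A p w) = 0")
    case True
    then show ?thesis
      using combination by simp
  next
    case False
    then show ?thesis
      using row_p assms(1) by metis
  qed
  then show ?thesis
    by (simp add: columns_dependent_def)
qed

text \<open>
  On the diagonal, \<open>u = w\<close>, the added product is the square of a \<open>GF(2)\<close> entry, hence that entry
  itself: this is why the loops at the neighbors are toggled together with the adjacencies. The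
  factor is \<open>adjacent G v u\<close> and not the matrix entry at \<open>(u, v)\<close>, since row \<open>v\<close> has to stay fixed
  even if \<open>v\<close> is looped. Column \<open>v\<close> is excluded, because local complementation does not change it
  whereas a loop at \<open>v\<close> would make the row operation do so.
\<close>

lemma adjacency_matrix_local_complement:
  assumes "v \<in> verts G" "u \<in> verts G" "w \<in> verts G" "w \<noteq> v"
  shows "adjacency_matrix (local_complement G v) u w =
    adjacency_matrix G u w + of_bool (adjacent G v u) * adjacency_matrix G v w"
  using assms
  by (auto simp: adjacency_matrix_def looped_local_complement adjacent_local_complement)

lemma columns_dependent_local_complement:
  assumes "v \<in> verts G" "S \<subseteq> verts G" "v \<notin> S"
  shows "columns_dependent (adjacency_matrix (local_complement G v)) (verts G) S \<longleftrightarrow>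
    columns_dependent (adjacency_matrix G) (verts G) S"
proof (rule columns_dependent_row_operation [where n = "\<lambda>u. of_bool (adjacent G v u)", OF assms(1)])
  show "of_bool (adjacent G v v) = (0::bit)"
    by (simp add: adjacent_def)
  show "adjacency_matrix (local_complement G v) u w =
      adjacency_matrix G u w + of_bool (adjacent G v u) * adjacency_matrix G v w"
    if "u \<in> verts G" "w \<in> S" for u w
    using that assms by (intro adjacency_matrix_local_complement) auto
qed

theorem theorem18:
  fixes G :: "('v, 'e) multigraph" and v :: 'v
  assumes "finite_multigraph G" and "v \<in> verts G"
  shows "matroid_delete (adjacency_matroid G) v
       = matroid_delete (adjacency_matroid (local_complement G v)) v"
proof -
  have verts: "verts (local_complement G v) = verts G"
    by (simp add: local_complement_def)
  have "S \<in> circuits (adjacency_matroid G) \<longleftrightarrow>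
      S \<in> circuits (adjacency_matroid (local_complement G v))" if "v \<notin> S" for S
  proof (cases "S \<subseteq> verts G")
    case True
    have "columns_dependent (adjacency_matrix (local_complement G v)) (verts G) T \<longleftrightarrow>
        columns_dependent (adjacency_matrix G) (verts G) T" if "T \<subseteq> S" for T
      using that True \<open>v \<notin> S\<close> by (intro columns_dependent_local_complement [OF assms(2)]) auto
    then show ?thesis
      by (simp add: adjacency_matroid_def verts psubset_imp_subset cong: imp_cong conj_cong)
  qed (simp add: adjacency_matroid_def verts)
  then have "{S \<in> circuits (adjacency_matroid G). v \<notin> S} =
      {S \<in> circuits (adjacency_matroid (local_complement G v)). v \<notin> S}"
    by blast
  moreover have "ground (adjacency_matroid (local_complement G v)) = ground (adjacency_matroid G)"
    by (simp add: adjacency_matroid_def verts)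
  ultimately show ?thesis
    by (simp add: matroid_delete_def)
qed

end
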